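(* Fix $\rho_{\mathrm{base}}\in\mathbb{R}$. Suppose that, starting from an action profile $\boldsymbol{x}(1)\in\Omega$, every prosumer $n\in\mathcal{N}$ updates its energy request at each time step $t=1,2,\ldots$ by the relaxation learning algorithm $$x_n(t+1)=\Big(1-\frac{1}{\sqrt{t}}\Big)x_n(t)+\frac{1}{\sqrt{t}}\,x_n^{r}(t),$$ where $x_n^{r}(t)$ is the best response of prosumer $n$ to the actions $\boldsymbol{x}_{-n}(t)$ of the other prosumers. Then the action profiles $\boldsymbol{x}(t)$ converge to a pure-strategy Nash equilibrium of the prosumers' game. Moreover, after $t$ steps the joint action profile $\boldsymbol{x}(t)$ is an $\epsilon$-Nash equilibrium with $\epsilon=O(t^{-1/4})$; i.e. there is a constant $C$ independent of $t$ such that $\boldsymbol{x}(t)$ is a $Ct^{-1/4}$-Nash equilibrium for all $t\ge 1$.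
   Context: Let $\mathcal{N}$ be a finite set of $N\ge 1$ prosumers. Each prosumer $n\in\mathcal{N}$ has real parameters $W_n$ (produced energy), $Q_n$ (initial stored energy), $L_n$ (load), and storage capacity $Q_{\max,n}\ge 0$. Its action $x_n$ (energy bought if positive, sold if negative) ranges over $\mathcal{X}_n=[x_{n,\min},x_{n,\max}]$, where $x_{n,\min}=-W_n-Q_n+L_n$ and $x_{n,\max}=-W_n-Q_n+L_n+Q_{\max,n}$; set $\Omega=\prod_{n\in\mathcal{N}}[x_{n,\min},x_{n,\max}]$. Let $\alpha>0$ be a fixed constant, $\rho_{\mathrm{base}}\in\mathbb{R}$ the (fixed) base price announced by the power company, and $\rho_f$ a random future price uniformly distributed on $[\rho_{\min},\rho_{\max}]$. Write $\boldsymbol{x}_{-n}$ for the actions of the prosumers other than $n$. The utility of prosumer $n$ is $$U_n(x_n,\boldsymbol{x}_{-n},\rho_{\mathrm{base}})=-\Big(\rho_{\mathrm{base}}+\alpha\big(x_n+\sum_{m\in\mathcal{N}\setminus\{n\}}x_m\big)\Big)x_n+(W_n+Q_n-L_n+x_n)\rho_f,$$ and its expected utility is $U^{\mathrm{CGT}}_n:=\mathbb{E}_{\rho_f}[U_n]$. In the prosumers' game each prosumer $n$ chooses $x_n\in\mathcal{X}_n$ to maximize $U^{\mathrm{CGT}}_n$. The best response of prosumer $n$ to $\boldsymbol{x}_{-n}$ is the (unique) maximizer of $x_n\mapsto U^{\mathrm{CGT}}_n(x_n,\boldsymbol{x}_{-n},\rho_{\mathrm{base}})$ over $\mathcal{X}_n$.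 For $\epsilon\ge 0$, an $\epsilon$-Nash equilibrium is a profile $\boldsymbol{x}\in\Omega$ such that $U^{\mathrm{CGT}}_n(y_n,\boldsymbol{x}_{-n},\rho_{\mathrm{base}})-U^{\mathrm{CGT}}_n(x_n,\boldsymbol{x}_{-n},\rho_{\mathrm{base}})\le\epsilon$ for all $n\in\mathcal{N}$ and $y_n\in\mathcal{X}_n$; a pure-strategy Nash equilibrium is the case $\epsilon=0$. *)

theory Defs
  imports "HOL-Probability.Probability"
begin

(* Prosumers are the elements of the finite type 'n, so that action profiles live in real ^ 'n. *)

definition min_action :: "('n \<Rightarrow> real) \<Rightarrow> ('n \<Rightarrow> real) \<Rightarrow> ('n \<Rightarrow> real) \<Rightarrow> 'n \<Rightarrow> real" where
  "min_action W Q L n = - W n - Q n + L n"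

definition max_action ::
  "('n \<Rightarrow> real) \<Rightarrow> ('n \<Rightarrow> real) \<Rightarrow> ('n \<Rightarrow> real) \<Rightarrow> ('n \<Rightarrow> real) \<Rightarrow> 'n \<Rightarrow> real" where
  "max_action W Q L Qmax n = - W n - Q n + L n + Qmax n"

definition action_set ::
  "('n \<Rightarrow> real) \<Rightarrow> ('n \<Rightarrow> real) \<Rightarrow> ('n \<Rightarrow> real) \<Rightarrow> ('n \<Rightarrow> real) \<Rightarrow> 'n \<Rightarrow> real set" where
  "action_set W Q L Qmax n = {min_action W Q L n..max_action W Q L Qmax n}"

definition profiles ::
  "('n::finite \<Rightarrow> real) \<Rightarrow> ('n \<Rightarrow> real) \<Rightarrow> ('n \<Rightarrow> real) \<Rightarrow> ('n \<Rightarrow> real) \<Rightarrow> (real ^ 'n) set" where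
  "profiles W Q L Qmax = {x. \<forall>n. x $ n \<in> action_set W Q L Qmax n}"

(* Here y is the action of prosumer n itself and the profile x enters only through the actions
   of the others (its n-th component is never used); r is the realised future price. *)
definition utility ::
  "('n::finite \<Rightarrow> real) \<Rightarrow> ('n \<Rightarrow> real) \<Rightarrow> ('n \<Rightarrow> real) \<Rightarrow> real \<Rightarrow> real \<Rightarrow>
    'n \<Rightarrow> real \<Rightarrow> real ^ 'n \<Rightarrow> real \<Rightarrow> real" where
  "utility W Q L \<alpha> \<rho>_base n y x r =
     - (\<rho>_base + \<alpha> * (y + (\<Sum>m\<in>UNIV - {n}. x $ m))) * y + (W n + Q n - L n + y) * r"

definition expected_utility ::
  "('n::finite \<Rightarrow> real) \<Rightarrow> ('n \<Rightarrow> real) \<Rightarrow> ('n \<Rightarrow> real) \<Rightarrow> real \<Rightarrow> 'w measure \<Rightarrow> ('w \<Rightarrow> real) \<Rightarrow>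
    real \<Rightarrow> 'n \<Rightarrow> real \<Rightarrow> real ^ 'n \<Rightarrow> real" where
  "expected_utility W Q L \<alpha> M \<rho>f \<rho>_base n y x =
     prob_space.expectation M (\<lambda>\<omega>. utility W Q L \<alpha> \<rho>_base n y x (\<rho>f \<omega>))"

definition best_response ::
  "('n::finite \<Rightarrow> real) \<Rightarrow> ('n \<Rightarrow> real) \<Rightarrow> ('n \<Rightarrow> real) \<Rightarrow> ('n \<Rightarrow> real) \<Rightarrow> real \<Rightarrow> 'w measure \<Rightarrow>
    ('w \<Rightarrow> real) \<Rightarrow> real \<Rightarrow> 'n \<Rightarrow> real ^ 'n \<Rightarrow> real" where
  "best_response W Q L Qmax \<alpha> M \<rho>f \<rho>_base n x =
     (THE y. is_arg_max (\<lambda>z. expected_utility W Q L \<alpha> M \<rho>f \<rho>_base n z x)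
               (\<lambda>z. z \<in> action_set W Q L Qmax n) y)"

definition eps_nash ::
  "('n::finite \<Rightarrow> real) \<Rightarrow> ('n \<Rightarrow> real) \<Rightarrow> ('n \<Rightarrow> real) \<Rightarrow> ('n \<Rightarrow> real) \<Rightarrow> real \<Rightarrow> 'w measure \<Rightarrow>
    ('w \<Rightarrow> real) \<Rightarrow> real \<Rightarrow> real \<Rightarrow> real ^ 'n \<Rightarrow> bool" where
  "eps_nash W Q L Qmax \<alpha> M \<rho>f \<rho>_base \<epsilon> x \<longleftrightarrow>
     0 \<le> \<epsilon> \<and> x \<in> profiles W Q L Qmax \<and>
     (\<forall>n. \<forall>y\<in>action_set W Q L Qmax n.
        expected_utility W Q L \<alpha> M \<rho>f \<rho>_base n y x
          - expected_utility W Q L \<alpha> M \<rho>f \<rho>_base n (x $ n) x \<le> \<epsilon>)"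

definition nash ::
  "('n::finite \<Rightarrow> real) \<Rightarrow> ('n \<Rightarrow> real) \<Rightarrow> ('n \<Rightarrow> real) \<Rightarrow> ('n \<Rightarrow> real) \<Rightarrow> real \<Rightarrow> 'w measure \<Rightarrow>
    ('w \<Rightarrow> real) \<Rightarrow> real \<Rightarrow> real ^ 'n \<Rightarrow> bool" where
  "nash W Q L Qmax \<alpha> M \<rho>f \<rho>_base x \<longleftrightarrow> eps_nash W Q L Qmax \<alpha> M \<rho>f \<rho>_base 0 x"

end

theory Submission
  imports Defs
begin

text \<open>
  Up to the factor \<open>- \<alpha>\<close>, all expected utilities share the exact potential
  \<open>F x = (x \<bullet> x + (u \<bullet> x)\<^sup>2) / 2 - c * (u \<bullet> x)\<close> with \<open>u\<close> the all-ones vector. Along the direction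
  \<open>d\<close> towards the best responses, \<open>F\<close> decreases at rate \<open>D = - (gradient \<bullet> d)\<close>; the optimality
  conditions give \<open>2 * (d \<bullet> d) \<le> D\<close>, so the second-order term is dominated once the step is small,
  and \<open>F x - min F \<le> D\<close>. Hence one step of size \<open>\<gamma>\<close> contracts the gap \<open>F x - min F\<close> by
  \<open>1 - \<gamma> / 2\<close>, which for \<open>\<gamma> = 1 / sqrt t\<close> makes it \<open>O(1 / sqrt t)\<close>. The gap bounds both the gain of
  every unilateral deviation and, by strong convexity, the squared distance to the minimiser.
\<close>

section \<open>The quadratic potential: expansion, growth at a minimiser, decrease in one
  step\<close>

definition potential :: "'a::real_inner \<Rightarrow> real \<Rightarrow> 'a \<Rightarrow> real" where
  "potential u c x = (x \<bullet> x + (u \<bullet> x)\<^sup>2) / 2 - c * (u \<bullet> x)"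

definition potential_grad :: "'a::real_inner \<Rightarrow> real \<Rightarrow> 'a \<Rightarrow> 'a" where
  "potential_grad u c x = x + (u \<bullet> x - c) *\<^sub>R u"

text \<open>The potential is quadratic, so its second-order Taylor expansion is exact.\<close>

lemma potential_add:
  "potential u c (x + h) =
     potential u c x + potential_grad u c x \<bullet> h + (h \<bullet> h + (u \<bullet> h)\<^sup>2) / 2"
  by (simp add: potential_def potential_grad_def inner_add_left inner_add_right
      inner_diff_left inner_diff_right inner_commute power2_eq_square field_simps)

lemma continuous_on_potential: "continuous_on S (potential u c)"
  unfolding potential_def by (intro continuous_intros) auto

text \<open>Comparing \<open>xs\<close> with the midpoint of the segment to \<open>y\<close>
  replaces a first-order optimality condition, at the price of the constant 4 instead of 2.\<close>

lemma potential_minimiser_growth: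
  assumes "convex S" "xs \<in> S" "y \<in> S"
    and min: "\<And>z. z \<in> S \<Longrightarrow> potential u c xs \<le> potential u c z"
  shows "(norm (y - xs))\<^sup>2 \<le> 4 * (potential u c y - potential u c xs)"
proof -
  define h where "h = y - xs"
  define q where "q = h \<bullet> h + (u \<bullet> h)\<^sup>2"
  have "xs + (1/2) *\<^sub>R h = (1/2) *\<^sub>R xs + (1/2) *\<^sub>R y"
    by (simp add: h_def algebra_simps flip: scaleR_add_left)
  then have "xs + (1/2) *\<^sub>R h \<in> S"
    using convexD[OF \<open>convex S\<close> \<open>xs \<in> S\<close> \<open>y \<in> S\<close>, of "1/2" "1/2"] by simp
  from min[OF this] have "0 \<le> potential_grad u c xs \<bullet> h / 2 + q / 8"
    by (simp add: potential_add q_def power2_eq_square field_simps)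
  moreover have "potential u c y = potential u c xs + potential_grad u c xs \<bullet> h + q / 2"
    using potential_add[of u c xs h] by (simp add: h_def q_def)
  ultimately have "q \<le> 4 * (potential u c y - potential u c xs)"
    by simp
  moreover have "(norm (y - xs))\<^sup>2 \<le> q"
    by (simp add: q_def h_def power2_norm_eq_inner)
  ultimately show ?thesis
    by linarith
qed

text \<open>\<open>vi\<close> is the first-order condition for \<open>r\<close> to minimise
  \<open>potential_grad u c x \<bullet> (z - x) + (z - x) \<bullet> (z - x)\<close> over
  \<open>z\<close> in \<open>S\<close>. For all-ones \<open>u\<close> the potential has second
  derivative 2 in each single coordinate, which is why the best-response profile satisfies
  it.\<close>

lemma potential_step:
  assumes vi: "\<And>y. y \<in> S \<Longrightarrow> 0 \<le> (potential_grad u c x + 2 *\<^sub>R (r - x)) \<bullet> (y - r)"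
    and "x \<in> S" "xs \<in> S" "0 \<le> \<gamma>" "\<gamma> * (1 + (norm u)\<^sup>2) \<le> 2"
  shows "potential u c (x + \<gamma> *\<^sub>R (r - x)) - potential u c xs
           \<le> (1 - \<gamma> / 2) * (potential u c x - potential u c xs)"
proof -
  define g where "g = potential_grad u c x"
  define d where "d = r - x"
  define e where "e = xs - x"
  define D where "D = - (g \<bullet> d)"
  have "0 \<le> (g + 2 *\<^sub>R d) \<bullet> (- d)"
    using vi[OF \<open>x \<in> S\<close>] by (simp add: g_def d_def)
  then have dD: "2 * (d \<bullet> d) \<le> D"
    by (simp add: D_def inner_add_left)
  have "0 \<le> (g + 2 *\<^sub>R d) \<bullet> (e - d)"
    using vi[OF \<open>xs \<in> S\<close>] by (simp add: g_def d_def e_def)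
  then have "- (g \<bullet> e) \<le> D + 2 * (d \<bullet> e) - 2 * (d \<bullet> d)"
    by (simp add: D_def inner_add_left inner_diff_right)
  moreover have "potential u c xs = potential u c x + g \<bullet> e + (e \<bullet> e + (u \<bullet> e)\<^sup>2) / 2"
    using potential_add[of u c x e] by (simp add: g_def e_def)
  \<comment> \<open>Completing the square: the leftover \<open>2 * (d \<bullet> e) - 2 * (d
    \<bullet> d) - (e \<bullet> e) / 2\<close> is minus half of this product.\<close>
  moreover have "0 \<le> (e - 2 *\<^sub>R d) \<bullet> (e - 2 *\<^sub>R d)"
    by (rule inner_ge_zero)
  then have "0 \<le> e \<bullet> e - 4 * (d \<bullet> e) + 4 * (d \<bullet> d)"
    by (simp add: inner_diff_left inner_diff_right inner_commute)
  moreover have "0 \<le> (u \<bullet> e)\<^sup>2"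
    by simp
  ultimately have gap: "potential u c x - potential u c xs \<le> D"
    by argo
  \<comment> \<open>Cauchy-Schwarz bounds the curvature along \<open>d\<close>; with the bound on
    \<open>\<gamma>\<close> the second-order term then costs at most half of the first-order gain
    \<open>\<gamma> * D\<close>.\<close>
  have "(u \<bullet> d)\<^sup>2 \<le> (norm u)\<^sup>2 * (d \<bullet> d)"
    using Cauchy_Schwarz_ineq[of u d] by (simp add: power2_norm_eq_inner)
  then have "d \<bullet> d + (u \<bullet> d)\<^sup>2 \<le> (1 + (norm u)\<^sup>2) * (d \<bullet> d)"
    by (simp add: algebra_simps)
  then have "\<gamma> * (d \<bullet> d + (u \<bullet> d)\<^sup>2) \<le> (\<gamma> * (1 + (norm u)\<^sup>2)) * (d \<bullet> d)"
    using \<open>0 \<le> \<gamma>\<close> by (simp add: mult_left_mono mult.assoc)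
  also have "\<dots> \<le> 2 * (d \<bullet> d)"
    using assms(5) by (intro mult_right_mono) auto
  finally have "\<gamma> * (\<gamma> * (d \<bullet> d + (u \<bullet> d)\<^sup>2)) \<le> \<gamma> * D"
    using dD \<open>0 \<le> \<gamma>\<close> by (intro mult_left_mono) auto
  moreover have "potential u c (x + \<gamma> *\<^sub>R d)
      = potential u c x - \<gamma> * D + \<gamma> * (\<gamma> * (d \<bullet> d + (u \<bullet> d)\<^sup>2)) / 2"
    by (simp add: potential_add g_def D_def power2_eq_square algebra_simps)
  moreover have "\<gamma> * (potential u c x - potential u c xs) \<le> \<gamma> * D"
    using gap \<open>0 \<le> \<gamma>\<close> by (rule mult_left_mono)
  moreover have "(1 - \<gamma> / 2) * (potential u c x - potential u c xs)
      = potential u c x - potential u c xs - \<gamma> * (potential u c x - potential u c xs) / 2"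
    by (simp add: field_simps)
  ultimately show ?thesis
    unfolding d_def[symmetric] by linarith
qed

section \<open>Real analysis: a decay rate and the maximiser of a parabola on an interval\<close>

lemma sqrt_decay_bound:
  fixes a :: "nat \<Rightarrow> real"
  assumes nonneg: "\<And>t. 1 \<le> t \<Longrightarrow> 0 \<le> a t"
    and "1 \<le> T"
    and step: "\<And>t. T \<le> t \<Longrightarrow> a (Suc t) \<le> (1 - 1 / sqrt t / 2) * a t"
  shows "\<exists>C. 0 \<le> C \<and> (\<forall>t\<ge>1. a t \<le> C / sqrt t)"
proof -
  \<comment> \<open>The weight grows by a factor of at most \<open>1 + 1 / (2 * t)\<close>, while
    \<open>a\<close> shrinks by \<open>1 - 1 / (2 * sqrt t)\<close>, which outweighs this as soon as
    \<open>1 \<le> t\<close>.\<close>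
  have mono: "sqrt (Suc t) * a (Suc t) \<le> sqrt t * a t" if "T \<le> t" for t
  proof -
    define s where "s = sqrt t"
    have "1 \<le> t"
      using \<open>1 \<le> T\<close> that by simp
    then have s: "1 \<le> s" "s\<^sup>2 = t"
      by (auto simp: s_def)
    have "(s + 1 / (2 * s))\<^sup>2 = s\<^sup>2 + 1 + (1 / (2 * s))\<^sup>2"
      using s(1) by (simp add: power2_sum)
    then have "sqrt (Suc t) \<le> s + 1 / (2 * s)"
      using s by (intro real_le_lsqrt) auto
    have "sqrt (Suc t) * a (Suc t) \<le> sqrt (Suc t) * ((1 - 1 / s / 2) * a t)"
      using step[OF that] by (intro mult_left_mono) (auto simp: s_def)
    also have "\<dots> \<le> (s + 1 / (2 * s)) * ((1 - 1 / s / 2) * a t)"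
      using \<open>sqrt (Suc t) \<le> _\<close> s nonneg[OF \<open>1 \<le> t\<close>]
      by (intro mult_right_mono mult_nonneg_nonneg) (auto simp: field_simps)
    also have "\<dots> = ((s + 1 / (2 * s)) * (1 - 1 / s / 2)) * a t"
      by simp
    also have "\<dots> \<le> s * a t"
    proof (rule mult_right_mono)
      have "(s + 1 / (2 * s)) * (1 - 1 / s / 2) = s - 1 / 2 + 1 / (2 * s) - 1 / (4 * s\<^sup>2)"
        using s(1) by (simp add: field_simps power2_eq_square)
      also have "\<dots> \<le> s"
      proof -
        have "1 / (2 * s) \<le> 1 / 2" "0 \<le> 1 / (4 * s\<^sup>2)"
          using s(1) by (auto simp: field_simps)
        then show ?thesis by linarith
      qed
      finally show "(s + 1 / (2 * s)) * (1 - 1 / s / 2) \<le> s" .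
      show "0 \<le> a t"
        using nonneg \<open>1 \<le> t\<close> by simp
    qed
    finally show ?thesis
      by (simp add: s_def)
  qed
  \<comment> \<open>All summands are nonnegative, so the sum bounds each weighted term up to
    \<open>T\<close>; beyond \<open>T\<close>, \<open>mono\<close> takes over.\<close>
  define C where "C = (\<Sum>t=1..T. sqrt t * a t)"
  have le_C: "sqrt t * a t \<le> C" if "1 \<le> t" "t \<le> T" for t
    unfolding C_def
    using that nonneg by (intro member_le_sum[where f = "\<lambda>t. sqrt (real t) * a t"]) auto
  have "sqrt t * a t \<le> C" if "1 \<le> t" for t
  proof (cases "t \<le> T")
    case True
    then show ?thesis using le_C that by blast
  next
    case False
    then have "T \<le> t" by simp
    then show ?thesis
    proof (induction t rule: dec_induct)
      case base
      then show ?case using le_C \<open>1 \<le> T\<close> by blast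
    next
      case (step k)
      then show ?case using mono[of k] by linarith
    qed
  qed
  moreover have "0 \<le> C"
    unfolding C_def using nonneg by (intro sum_nonneg) auto
  ultimately show ?thesis
    by (intro exI[of _ C]) (auto simp: field_simps)
qed

text \<open>\<open>r\<close> is the projection of the vertex \<open>b\<close> onto the interval. Its
  variational inequality, the last claim, makes \<open>r\<close> a strict maximiser, so the definite
  description is well defined.\<close>

lemma is_arg_max_neg_square_interval:
  fixes b p k lo hi :: real
  assumes "lo \<le> hi" "0 < k"
    and f: "\<And>z. f z = p - k * (z - b)\<^sup>2"
  defines "r \<equiv> max lo (min hi b)"
  shows "(THE y. is_arg_max f (\<lambda>z. z \<in> {lo..hi}) y) = r"
    and "r \<in> {lo..hi}"
    and "\<And>y. y \<in> {lo..hi} \<Longrightarrow> 0 \<le> (r - b) * (y - r)"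
proof -
  show r: "r \<in> {lo..hi}"
    using assms by auto
  show vi: "0 \<le> (r - b) * (y - r)" if "y \<in> {lo..hi}" for y
    using that by (auto simp: r_def max_def min_def zero_le_mult_iff)
  have less: "f y < f r" if "y \<in> {lo..hi}" "y \<noteq> r" for y
  proof -
    have "(y - b)\<^sup>2 = (r - b)\<^sup>2 + 2 * ((r - b) * (y - r)) + (y - r)\<^sup>2"
      by (simp add: power2_eq_square algebra_simps)
    moreover have "0 < (y - r)\<^sup>2"
      using that by simp
    ultimately have "(r - b)\<^sup>2 < (y - b)\<^sup>2"
      using vi[OF that(1)] by linarith
    then show ?thesis
      using \<open>0 < k\<close> by (simp add: f)
  qed
  show "(THE y. is_arg_max f (\<lambda>z. z \<in> {lo..hi}) y) = r"
  proof (rule the_equality)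
    show "is_arg_max f (\<lambda>z. z \<in> {lo..hi}) r"
      unfolding is_arg_max_def using r less by (metis less_asym order_less_irrefl)
    show "y = r" if "is_arg_max f (\<lambda>z. z \<in> {lo..hi}) y" for y
      using that r less unfolding is_arg_max_def by blast
  qed
qed

section \<open>Expected utilities and best responses in terms of the potential\<close>

lemma profiles_eq_cbox:
  "profiles W Q L Qmax = cbox (\<chi> n. min_action W Q L n) (\<chi> n. max_action W Q L Qmax n)"
  by (auto simp: profiles_def action_set_def mem_box_cart)

lemma inner_1_vec: "1 \<bullet> x = (\<Sum>n\<in>UNIV. x $ n)" for x :: "real ^ 'n"
  by (simp add: inner_vec_def)

lemma integrable_uniform:
  fixes \<rho>f :: "'w \<Rightarrow> real"
  assumes "prob_space M" "a < b"
    and "distributed M lborel \<rho>f (\<lambda>r. indicator {a..b} r / measure lborel {a..b})"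
  shows "integrable M \<rho>f"
proof -
  interpret prob_space M by fact
  have "integrable lborel (\<lambda>r. r / measure lborel {a..b} * indicator {a..b} r)"
    by (rule borel_integrable_atLeastAtMost) (use \<open>a < b\<close> in \<open>auto intro!: continuous_intros\<close>)
  then have "integrable lborel (\<lambda>r. indicator {a..b} r / measure lborel {a..b} * r)"
    by (rule back_subst[where P = "integrable lborel"]) (simp add: fun_eq_iff)
  then show ?thesis
    using distributed_integrable[OF assms(3), of "\<lambda>r. r"] by simp
qed

text \<open>The utility is affine in the future price, so only the mean price matters.\<close>

lemma expected_utility_eq:
  fixes \<rho>f :: "'w \<Rightarrow> real"
  assumes "prob_space M" "integrable M \<rho>f"
  shows "expected_utility W Q L \<alpha> M \<rho>f \<rho>_base n y x =
    - (\<rho>_base + \<alpha> * (y + (\<Sum>m\<in>UNIV. x $ m) - x $ n)) * y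
      + (W n + Q n - L n + y) * prob_space.expectation M \<rho>f"
proof -
  interpret prob_space M by fact
  have "(\<Sum>m\<in>UNIV - {n}. x $ m) = (\<Sum>m\<in>UNIV. x $ m) - x $ n"
    by (simp add: sum_diff1)
  then show ?thesis
    using assms(2) unfolding expected_utility_def utility_def
    by (simp add: prob_space add_diff_eq del: sum_diff1)
qed

text \<open>With \<open>s\<close> the total of the others, both sides depend on the own action
  \<open>y\<close> through \<open>- \<alpha> * (y\<^sup>2 + (s - c) * y)\<close>; the two halved
  squares in the potential supply \<open>y\<^sup>2 + s * y\<close>.\<close>

lemma expected_utility_deviation:
  fixes \<rho>f :: "'w \<Rightarrow> real" and x :: "real ^ 'n" and \<rho>_base :: real
  assumes "prob_space M" "integrable M \<rho>f" "0 < \<alpha>"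
  defines "c \<equiv> (prob_space.expectation M \<rho>f - \<rho>_base) / \<alpha>"
  shows "expected_utility W Q L \<alpha> M \<rho>f \<rho>_base n y x
           - expected_utility W Q L \<alpha> M \<rho>f \<rho>_base n (x $ n) x
         = \<alpha> * (potential 1 c x - potential 1 c (x + axis n (y - x $ n)))"
proof -
  have c: "prob_space.expectation M \<rho>f = \<rho>_base + \<alpha> * c"
    using \<open>0 < \<alpha>\<close> by (simp add: c_def)
  have "1 \<bullet> axis n (y - x $ n) = y - x $ n"
    by (simp add: inner_axis)
  moreover have "axis n (y - x $ n) \<bullet> axis n (y - x $ n) = (y - x $ n)\<^sup>2"
    by (simp add: inner_axis power2_eq_square)
  ultimately show ?thesis
    unfolding expected_utility_eq[OF assms(1,2)] potential_add c
    by (simp add: potential_grad_def inner_axis inner_add_left inner_1_vec power2_eq_square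
        field_simps)
qed

text \<open>The second claim is coordinate \<open>n\<close> of the hypothesis \<open>vi\<close> of
  \<open>potential_step\<close>: the bracket equals \<open>2 * (r - b)\<close>, where
  \<open>b\<close> is the vertex of the own-action parabola.\<close>

lemma best_response_properties:
  fixes \<rho>f :: "'w \<Rightarrow> real" and x :: "real ^ 'n" and \<rho>_base :: real
    and W Q L :: "'n \<Rightarrow> real"
  assumes "prob_space M" "integrable M \<rho>f" "0 < \<alpha>" "0 \<le> Qmax n"
  defines "c \<equiv> (prob_space.expectation M \<rho>f - \<rho>_base) / \<alpha>"
    and "r \<equiv> best_response W Q L Qmax \<alpha> M \<rho>f \<rho>_base n x"
  shows "r \<in> action_set W Q L Qmax n"
    and "y \<in> action_set W Q L Qmax n \<Longrightarrow>
           0 \<le> (potential_grad 1 c x $ n + 2 * (r - x $ n)) * (y - r)"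
proof -
  define s where "s = (\<Sum>m\<in>UNIV. x $ m) - x $ n"
  define b where "b = (c - s) / 2"
  define p where "p = \<alpha> * b\<^sup>2 + (W n + Q n - L n) * prob_space.expectation M \<rho>f"
  have c: "prob_space.expectation M \<rho>f = \<rho>_base + \<alpha> * c"
    using \<open>0 < \<alpha>\<close> by (simp add: c_def)
  have u: "expected_utility W Q L \<alpha> M \<rho>f \<rho>_base n z x = p - \<alpha> * (z - b)\<^sup>2" for z
    unfolding expected_utility_eq[OF assms(1,2)] p_def b_def s_def c
    by (simp add: power2_eq_square field_simps)
  have le: "min_action W Q L n \<le> max_action W Q L Qmax n"
    using assms(4) by (simp add: min_action_def max_action_def)
  note * = is_arg_max_neg_square_interval[OF le \<open>0 < \<alpha>\<close> u, folded action_set_def]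
  show "r \<in> action_set W Q L Qmax n"
    unfolding r_def best_response_def *(1) by (rule *(2))
  assume "y \<in> action_set W Q L Qmax n"
  then have "0 \<le> 2 * ((r - b) * (y - r))"
    unfolding r_def best_response_def *(1) by (intro mult_nonneg_nonneg *(3)) simp
  moreover have "potential_grad 1 c x $ n + 2 * (r - x $ n) = 2 * (r - b)"
    by (simp add: potential_grad_def inner_1_vec b_def s_def field_simps)
  ultimately show "0 \<le> (potential_grad 1 c x $ n + 2 * (r - x $ n)) * (y - r)"
    by (simp only: mult.assoc)
qed

section \<open>Convergence of the relaxation dynamics\<close>

theorem theorem3:
  fixes W Q L Qmax :: "'n::finite \<Rightarrow> real"
    and \<alpha> \<rho>_base \<rho>_min \<rho>_max :: real
    and M :: "'w measure"
    and \<rho>f :: "'w \<Rightarrow> real"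
    and x :: "nat \<Rightarrow> real ^ 'n"
  assumes "\<And>n. 0 \<le> Qmax n"
    and "0 < \<alpha>"
    and "prob_space M"
    and "\<rho>_min < \<rho>_max"
    and "distributed M lborel \<rho>f
           (\<lambda>r. indicator {\<rho>_min..\<rho>_max} r / measure lborel {\<rho>_min..\<rho>_max})"
    and "x 1 \<in> profiles W Q L Qmax"
    and "\<And>t n. 1 \<le> t \<Longrightarrow>
           x (t + 1) $ n = (1 - 1 / sqrt (real t)) * x t $ n
             + 1 / sqrt (real t) * best_response W Q L Qmax \<alpha> M \<rho>f \<rho>_base n (x t)"
  shows "(\<exists>xs. nash W Q L Qmax \<alpha> M \<rho>f \<rho>_base xs \<and> x \<longlonglongrightarrow> xs) \<and>
         (\<exists>C. \<forall>t\<ge>1. eps_nash W Q L Qmax \<alpha> M \<rho>f \<rho>_base (C * real t powr (- (1 / 4))) (x t))"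
proof -
  define \<Omega> where "\<Omega> = profiles W Q L Qmax"
  define u :: "real ^ 'n" where "u = 1"
  define c where "c = (prob_space.expectation M \<rho>f - \<rho>_base) / \<alpha>"
  define r where "r = (\<lambda>t. \<chi> n. best_response W Q L Qmax \<alpha> M \<rho>f \<rho>_base n (x t))"
  note int = integrable_uniform[OF assms(3,4,5)]
  note br = best_response_properties[where Qmax = Qmax, OF assms(3) int assms(2,1), where \<rho>_base = \<rho>_base,
      folded c_def u_def]
  note gain = expected_utility_deviation[OF assms(3) int assms(2), where \<rho>_base = \<rho>_base and W = W,
      folded c_def u_def]
  have compact: "compact \<Omega>" and convex: "convex \<Omega>"
    by (auto simp: \<Omega>_def profiles_eq_cbox)
  have r_mem: "r t \<in> \<Omega>" for t
    using br(1) by (simp add: \<Omega>_def profiles_def r_def)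
  \<comment> \<open>\<open>\<Omega>\<close> is a product set, so the coordinatewise inequalities can
    be summed.\<close>
  have vi: "0 \<le> (potential_grad u c (x t) + 2 *\<^sub>R (r t - x t)) \<bullet> (y - r t)" if "y \<in> \<Omega>" for t y
    unfolding inner_vec_def
    using that br(2) by (intro sum_nonneg) (simp add: \<Omega>_def profiles_def r_def)
  have step: "x (Suc t) = x t + (1 / sqrt t) *\<^sub>R (r t - x t)" if "1 \<le> t" for t
    using assms(7)[OF that] by (simp add: vec_eq_iff r_def algebra_simps diff_divide_distrib)
  \<comment> \<open>From \<open>t = 1\<close> on the step sizes lie in \<open>[0, 1]\<close>, so
    each update is a convex combination.\<close>
  have mem: "x t \<in> \<Omega>" if "1 \<le> t" for t
    using that
  proof (induction t rule: dec_induct)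
    case base
    show ?case using assms(6) by (simp add: \<Omega>_def)
  next
    case (step t)
    then have "x (Suc t) = (1 - 1 / sqrt t) *\<^sub>R x t + (1 / sqrt t) *\<^sub>R r t"
      using \<open>1 \<le> t \<Longrightarrow> x (Suc t) = _\<close> by (simp add: algebra_simps)
    also have "\<dots> \<in> \<Omega>"
      using step by (intro convexD[OF convex] r_mem) auto
    finally show ?case .
  qed
  obtain xs where xs: "xs \<in> \<Omega>" and min: "\<And>z. z \<in> \<Omega> \<Longrightarrow> potential u c xs \<le> potential u c z"
    using continuous_attains_inf[OF compact _ continuous_on_potential, of u c] mem[of 1] by auto
  define a where "a t = potential u c (x t) - potential u c xs" for t
  \<comment> \<open>From \<open>T0\<close> on, \<open>1 / sqrt t\<close> is small enough for
    \<open>potential_step\<close>; earlier times only affect the constant \<open>C\<close>.\<close>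
  obtain T0 :: nat where T0: "(1 + (norm u)\<^sup>2)\<^sup>2 \<le> T0"
    using real_arch_simple by blast
  have contract: "a (Suc t) \<le> (1 - 1 / sqrt t / 2) * a t" if "max 1 T0 \<le> t" for t
  proof -
    have "(1 + (norm u)\<^sup>2)\<^sup>2 \<le> t"
      using T0 that by (meson max.boundedE of_nat_mono order_trans)
    then have "1 + (norm u)\<^sup>2 \<le> sqrt t"
      by (rule real_le_rsqrt)
    also have "\<dots> \<le> 2 * sqrt t"
      by simp
    finally have "1 / sqrt t * (1 + (norm u)\<^sup>2) \<le> 2"
      using that by (simp add: field_simps)
    moreover have "1 \<le> t"
      using that by simp
    ultimately show ?thesis
      unfolding a_def step[OF \<open>1 \<le> t\<close>] by (intro potential_step[where S = \<Omega>] vi mem xs) auto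
  qed
  obtain C where "0 \<le> C" and C: "\<And>t. 1 \<le> t \<Longrightarrow> a t \<le> C / sqrt t"
    using sqrt_decay_bound[of a "max 1 T0"] contract min mem by (auto simp: a_def)
  \<comment> \<open>A deviation stays in \<open>\<Omega>\<close>, so it cannot lower the potential
    by more than the gap. This serves both \<open>xs\<close>, with \<open>\<epsilon> = 0\<close>,
    and the iterates.\<close>
  have gain_le: "eps_nash W Q L Qmax \<alpha> M \<rho>f \<rho>_base \<epsilon> z"
    if "z \<in> \<Omega>" "0 \<le> \<epsilon>" "\<alpha> * (potential u c z - potential u c xs) \<le> \<epsilon>" for z \<epsilon>
    unfolding eps_nash_def
  proof (intro conjI allI ballI)
    fix n y assume "y \<in> action_set W Q L Qmax n"
    then have "z + axis n (y - z $ n) \<in> \<Omega>"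
      using \<open>z \<in> \<Omega>\<close> by (auto simp: \<Omega>_def profiles_def axis_def)
    from min[OF this]
    have "\<alpha> * (potential u c z - potential u c (z + axis n (y - z $ n)))
        \<le> \<alpha> * (potential u c z - potential u c xs)"
      using \<open>0 < \<alpha>\<close> by simp
    then show "expected_utility W Q L \<alpha> M \<rho>f \<rho>_base n y z
        - expected_utility W Q L \<alpha> M \<rho>f \<rho>_base n (z $ n) z \<le> \<epsilon>"
      using that(3) unfolding gain by linarith
  qed (use that in \<open>auto simp: \<Omega>_def\<close>)
  have "nash W Q L Qmax \<alpha> M \<rho>f \<rho>_base xs"
    unfolding nash_def by (rule gain_le) (simp_all add: xs)
  moreover have "x \<longlonglongrightarrow> xs"
  proof -
    have "(\<lambda>t. (norm (x t - xs))\<^sup>2) \<longlonglongrightarrow> 0"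
    proof (rule Lim_null_comparison)
      \<comment> \<open>The dynamics start at \<open>t = 1\<close>; \<open>x 0\<close> is arbitrary
        and is discarded here.\<close>
      show "\<forall>\<^sub>F t in sequentially. norm ((norm (x t - xs))\<^sup>2) \<le> 4 * (C / sqrt t)"
        using eventually_ge_at_top[of 1]
      proof eventually_elim
        case (elim t)
        from potential_minimiser_growth[OF convex xs mem[OF elim] min] C[OF elim]
        show ?case by (simp add: a_def)
      qed
      show "(\<lambda>t. 4 * (C / sqrt t)) \<longlonglongrightarrow> 0"
        by real_asymp
    qed
    then show ?thesis
      by (simp add: LIM_zero_iff tendsto_norm_zero_iff)
  qed
  moreover have "eps_nash W Q L Qmax \<alpha> M \<rho>f \<rho>_base (\<alpha> * C * real t powr (- (1 / 4))) (x t)"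
    if "1 \<le> t" for t
  proof (rule gain_le)
    \<comment> \<open>The gap is even of order \<open>t powr (- (1 / 2))\<close>, which is stronger
      than the claimed rate because \<open>1 \<le> t\<close>.\<close>
    have "1 / sqrt t = real t powr (- (1 / 2))"
      using that by (simp add: powr_minus_divide powr_half_sqrt)
    also have "\<dots> \<le> real t powr (- (1 / 4))"
      using that by (intro powr_mono) auto
    finally have "C * (1 / sqrt t) \<le> C * real t powr (- (1 / 4))"
      using \<open>0 \<le> C\<close> by (rule mult_left_mono)
    with C[OF that] have "a t \<le> C * real t powr (- (1 / 4))"
      by simp
    then show "\<alpha> * (potential u c (x t) - potential u c xs) \<le> \<alpha> * C * real t powr (- (1 / 4))"
      using \<open>0 < \<alpha>\<close> by (simp add: a_def mult.assoc)
  qed (use that mem \<open>0 \<le> C\<close> \<open>0 < \<alpha>\<close> in auto)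
  ultimately show ?thesis
    by blast
qed

end
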